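(* Let $q\in[0,1)$ and let $(T_n)_{n\ge 1}$ be the BCMRT$(q)$ process. Let $N_1(n)$ be the number of nodes of degree $1$ (leaves) in $T_n$. Then $\mathrm{Var}(N_1(n))=\Omega(n)$ as $n\to\infty$.
   Context: BCMRT$(q)$ (balanced community modulated random recursive tree), $q\in[0,1]$: $T_1$ is a single edge (the root edge) joining two nodes with time-label $1$, one of type $A$, denoted $(1,A)$, and one of type $B$, denoted $(1,B)$. At each step $n\ge 2$, two new nodes with time-label $n$, namely $(n,A)$ of type $A$ and $(n,B)$ of type $B$, are added to the tree $T_{n-1}$ of size $2(n-1)$: (1) the two nodes independently (of each other and of the past) decide to connect to a node of their own type with probability $1-q$, or to a node of the other type with probability $q$; (2) each then independently chooses its parent uniformly among the $n-1$ nodes of $T_{n-1}$ of the selected type and is joined to it by an edge. This yields the tree $T_n$ of size $2n$. The notation $a_n=\Omega(n)$ means that there is $c>0$ (possibly depending on the fixed $q$) with $a_n\ge cn$ for all $n$ large enough. *)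

theory Defs
  imports "HOL-Probability.Probability" "HOL-Library.Landau_Symbols"
begin

datatype ctype = Type_A | Type_B

fun other_type :: "ctype \<Rightarrow> ctype" where
  "other_type Type_A = Type_B"
| "other_type Type_B = Type_A"

text \<open>A node is a time-label together with a type. A tree is given by its set of (undirected)
  edges, each edge being the set of its two endpoints. No isolated nodes ever occur, so the node
  set is recovered as the union of the edges.\<close>

type_synonym node = "nat \<times> ctype"
type_synonym tree = "node set set"

definition nodes :: "tree \<Rightarrow> node set" where
  "nodes T = \<Union>T"

definition nodes_of_type :: "tree \<Rightarrow> ctype \<Rightarrow> node set" where
  "nodes_of_type T t = {v \<in> nodes T. snd v = t}"

definition degree :: "tree \<Rightarrow> node \<Rightarrow> nat" where
  "degree T v = card {e \<in> T. v \<in> e}"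

definition num_leaves :: "tree \<Rightarrow> nat" where
  "num_leaves T = card {v \<in> nodes T. degree T v = 1}"

definition choose_type :: "real \<Rightarrow> ctype \<Rightarrow> ctype pmf" where
  "choose_type q t = map_pmf (\<lambda>b. if b then other_type t else t) (bernoulli_pmf q)"

definition choose_parent :: "real \<Rightarrow> tree \<Rightarrow> ctype \<Rightarrow> node pmf" where
  "choose_parent q T t = bind_pmf (choose_type q t) (\<lambda>s. pmf_of_set (nodes_of_type T s))"

text \<open>One step of the Markov chain: both nodes labelled \<open>n\<close> choose their parents independently,
  and both among the nodes of the old tree \<open>T\<close>.\<close>

definition bcmrt_step :: "real \<Rightarrow> nat \<Rightarrow> tree \<Rightarrow> tree pmf" where
  "bcmrt_step q n T =
     map_pmf (\<lambda>(u, v). T \<union> {{(n, Type_A), u}, {(n, Type_B), v}})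
       (pair_pmf (choose_parent q T Type_A) (choose_parent q T Type_B))"

text \<open>\<open>bcmrt q n\<close> is the law of the tree of size \<open>2 * n\<close>. The process starts at \<open>n = 1\<close>; the value at
  \<open>0\<close> is a dummy.\<close>

fun bcmrt :: "real \<Rightarrow> nat \<Rightarrow> tree pmf" where
  "bcmrt q 0 = return_pmf {}"
| "bcmrt q (Suc 0) = return_pmf {{(1, Type_A), (1, Type_B)}}"
| "bcmrt q (Suc (Suc n)) = bind_pmf (bcmrt q (Suc n)) (bcmrt_step q (Suc (Suc n)))"

text \<open>The node set is always as expected; in particular \<open>pmf_of_set\<close> above is only ever applied
  to finite nonempty sets.\<close>

lemma nodes_of_type_eq_if: "nodes T = {1..n} \<times> UNIV \<Longrightarrow> nodes_of_type T t = {1..n} \<times> {t}"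
  by (auto simp: nodes_of_type_def)

lemma nodes_bcmrt:
  assumes "T \<in> set_pmf (bcmrt q n)"
  shows "nodes T = {1..n} \<times> UNIV"
  using assms
proof (induction q n arbitrary: T rule: bcmrt.induct)
  case (1 q)
  then show ?case by (simp add: nodes_def)
next
  case (2 q)
  have "t = Type_A \<or> t = Type_B" for t by (cases t) auto
  with 2 show ?case by (auto simp: nodes_def)
next
  case (3 q n)
  then obtain S u v where S: "S \<in> set_pmf (bcmrt q (Suc n))"
    and u: "u \<in> set_pmf (choose_parent q S Type_A)"
    and v: "v \<in> set_pmf (choose_parent q S Type_B)"
    and T: "T = S \<union> {{(Suc (Suc n), Type_A), u}, {(Suc (Suc n), Type_B), v}}"
    by (auto simp: bcmrt_step_def)
  have nodes_S: "nodes S = {1..Suc n} \<times> UNIV"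
    using "3.IH" S by blast
  have "set_pmf (choose_parent q S t) \<subseteq> nodes S" for t
    unfolding choose_parent_def nodes_S
    by (auto simp: nodes_of_type_eq_if[OF nodes_S] set_pmf_of_set)
  then have "u \<in> nodes S" "v \<in> nodes S"
    using u v by blast+
  then have "nodes T = insert (Suc (Suc n), Type_A) (insert (Suc (Suc n), Type_B) (nodes S))"
    by (auto simp: T nodes_def)
  also have "\<dots> = {1..Suc (Suc n)} \<times> UNIV"
  proof -
    have "t = Type_A \<or> t = Type_B" for t by (cases t) auto
    then show ?thesis unfolding nodes_S by (auto simp: le_Suc_eq)
  qed
  finally show ?case .
qed

lemma nodes_of_type_bcmrt:
  "T \<in> set_pmf (bcmrt q n) \<Longrightarrow> nodes_of_type T t = {1..n} \<times> {t}"
  by (rule nodes_of_type_eq_if[OF nodes_bcmrt])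

end

theory Submission imports Defs
begin

text \<open>
  Write \<open>N\<close> for the number of leaves of the tree with \<open>m\<close> nodes of each type, and \<open>k = q (1 - q)\<close>.
  A new pair of nodes adds two leaves and removes the chosen parents that were leaves. Both parents
  are the same given node with probability \<open>k / m\<^sup>2\<close>, whatever its type, and the two probabilities of
  choosing a given node add up to \<open>1 / m\<close>. Hence the conditional mean of the next leaf count is
  \<open>\<rho> N + 2\<close> with \<open>\<rho> = 1 - 1 / m + k / m\<^sup>2\<close>, an affine function of \<open>N\<close> alone, and the law of total
  variance reads \<open>Var N' = \<rho>\<^sup>2 Var N + E c\<close>, where \<open>c\<close> is the conditional variance of one step.
  The same affine recursion holds for the leaves of a single type, so their first two moments
  show that their number is about \<open>m / 2\<close> in mean square. Each parent is therefore a leaf with probability about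
  \<open>1 / 2\<close>, which keeps \<open>E c\<close> away from \<open>0\<close>, and the recursion forces linear growth.
\<close>

section \<open>Leaves of a tree and their change when a pair of nodes is attached\<close>

lemma UNIV_ctype: "(UNIV :: ctype set) = {Type_A, Type_B}"
  using ctype.exhaust by auto

lemma finite_UNIV_ctype [simp]: "finite (UNIV :: ctype set)"
  by (simp add: UNIV_ctype)

lemma card_optional_pair:
  "x \<noteq> y \<Longrightarrow> card ((if P then {x} else {}) \<union> (if Q then {y} else {}))
    = (if P then 1 else 0) + (if Q then 1 else 0)"
  by simp

definition leaves :: "tree \<Rightarrow> node set" where
  "leaves T = {v \<in> nodes T. degree T v = 1}"

definition leaves_of_type :: "tree \<Rightarrow> ctype \<Rightarrow> node set" where
  "leaves_of_type T t = {v \<in> leaves T. snd v = t}"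

definition attach :: "nat \<Rightarrow> tree \<Rightarrow> node \<Rightarrow> node \<Rightarrow> tree" where
  "attach n T u v = T \<union> {{(n, Type_A), u}, {(n, Type_B), v}}"

text \<open>Old degrees are at least 1 and only grow, so an old node is a leaf afterwards exactly if
  it was one before and was not chosen as a parent. The two newcomers have degree 1.\<close>

lemma leaves_attach:
  assumes nodes: "nodes T = {1..m} \<times> UNIV" and u: "u \<in> nodes T" and v: "v \<in> nodes T"
  shows "leaves (attach (Suc m) T u v)
    = (leaves T - {u, v}) \<union> {(Suc m, Type_A), (Suc m, Type_B)}"
proof -
  let ?T = "attach (Suc m) T u v" and ?a = "(Suc m, Type_A)" and ?b = "(Suc m, Type_B)"
  have finT: "finite T"
    using nodes by (intro finite_UnionD) (simp add: nodes_def)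
  have a: "?a \<notin> nodes T" and b: "?b \<notin> nodes T"
    by (auto simp: nodes)
  \<comment> \<open>Both edges are new and distinct, since the newcomers are not in the old tree. So
    a node chosen by both newcomers really gains two edges.\<close>
  have eT: "{?a, u} \<notin> T" "{?b, v} \<notin> T" "{?a, u} \<noteq> {?b, v}"
    using a b u v by (auto simp: nodes_def doubleton_eq_iff)
  have nodes': "nodes ?T = nodes T \<union> {?a, ?b}"
    using u v by (auto simp: nodes_def attach_def)
  have deg_pos: "degree T w \<ge> 1" if w: "w \<in> nodes T" for w
  proof -
    have "{e \<in> T. w \<in> e} \<noteq> {}"
      using w by (auto simp: nodes_def)
    with finT show ?thesis
      by (simp add: degree_def Suc_le_eq card_gt_0_iff)
  qed
  have deg_old: "degree ?T w = degree T w + (if w = u then 1 else 0) + (if w = v then 1 else 0)"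
    if w: "w \<in> nodes T" for w
  proof -
    have "w \<noteq> ?a" "w \<noteq> ?b"
      using w a b by auto
    then have "{e \<in> ?T. w \<in> e}
      = {e \<in> T. w \<in> e} \<union> ((if w = u then {{?a, u}} else {}) \<union> (if w = v then {{?b, v}} else {}))"
      by (auto simp: attach_def)
    also have "card \<dots> = card {e \<in> T. w \<in> e}
      + card ((if w = u then {{?a, u}} else {}) \<union> (if w = v then {{?b, v}} else {}))"
      using finT eT by (intro card_Un_disjoint) auto
    also have "card ((if w = u then {{?a, u}} else {}) \<union> (if w = v then {{?b, v}} else {}))
      = (if w = u then 1 else 0) + (if w = v then 1 else 0)"
      using eT(3) by (rule card_optional_pair)
    finally show ?thesis
      by (simp add: degree_def)
  qed
  have "{e \<in> ?T. ?a \<in> e} = {{?a, u}}" "{e \<in> ?T. ?b \<in> e} = {{?b, v}}"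
    using a b u v by (auto simp: attach_def nodes_def)
  then have "degree ?T ?a = 1" "degree ?T ?b = 1"
    by (simp_all add: degree_def)
  moreover have "degree ?T w = 1 \<longleftrightarrow> degree T w = 1 \<and> w \<noteq> u \<and> w \<noteq> v" if "w \<in> nodes T" for w
    using deg_old[OF that] deg_pos[OF that] by auto
  ultimately show ?thesis
    using nodes' unfolding leaves_def by auto
qed

text \<open>The number of elements of \<open>L \<inter> {u, v}\<close>, in a form whose expectation is immediate.\<close>

definition hits :: "node set \<Rightarrow> node \<Rightarrow> node \<Rightarrow> real" where
  "hits L u v = of_bool (u \<in> L) + of_bool (v \<in> L) - of_bool (u = v \<and> u \<in> L)"

lemma card_Diff_hits:
  assumes "finite L"
  shows "real (card (L - {u, v})) = real (card L) - hits L u v"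
proof -
  have "real (card (L - {u, v})) = real (card L) - real (card (L \<inter> {u, v}))"
    using assms by (simp add: card_Diff_subset_Int card_mono)
  also have "real (card (L \<inter> {u, v})) = hits L u v"
    by (auto simp: hits_def Int_insert_right)
  finally show ?thesis .
qed

text \<open>The collision indicator absorbs the other two under multiplication, so it occurs with
  coefficient 1 - 2 - 2 = -3.\<close>

lemma hits_square:
  "(hits L u v)\<^sup>2 = of_bool (u \<in> L) + of_bool (v \<in> L) + 2 * (of_bool (u \<in> L) * of_bool (v \<in> L))
    - 3 * of_bool (u = v \<and> u \<in> L)"
  by (auto simp: hits_def power2_eq_square)

text \<open>\<open>hits\<close> takes only the values 0, 1 and 2. This crude bound keeps products of
  hitting probabilities out of the second-moment estimate for the leaves of one type.\<close>

lemma one_minus_hits_square_le: "(1 - hits L u v)\<^sup>2 \<le> 1"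
  by (auto simp: hits_def power2_eq_square)

lemma finite_leaves: "nodes T = {1..m} \<times> UNIV \<Longrightarrow> finite (leaves T)"
  by (simp add: leaves_def)

lemma num_leaves_eq_card: "num_leaves T = card (leaves T)"
  by (simp add: num_leaves_def leaves_def)

lemma card_leaves_eq:
  assumes "finite (leaves T)"
  shows "card (leaves T) = card (leaves_of_type T Type_A) + card (leaves_of_type T Type_B)"
proof -
  have "leaves T = leaves_of_type T Type_A \<union> leaves_of_type T Type_B"
    using UNIV_ctype by (auto simp: leaves_of_type_def)
  moreover have "leaves_of_type T Type_A \<inter> leaves_of_type T Type_B = {}"
    by (auto simp: leaves_of_type_def)
  ultimately show ?thesis
    using assms by (metis card_Un_disjoint finite_Un)
qed

lemma card_leaves_of_type_le:
  assumes "nodes T = {1..m} \<times> UNIV"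
  shows "card (leaves_of_type T t) \<le> m"
proof -
  have "leaves_of_type T t \<subseteq> {1..m} \<times> {t}"
    using assms by (auto simp: leaves_of_type_def leaves_def)
  then have "card (leaves_of_type T t) \<le> card ({1..m} \<times> {t})"
    by (intro card_mono) auto
  then show ?thesis by (simp add: card_cartesian_product)
qed

lemma num_leaves_attach:
  assumes "nodes T = {1..m} \<times> UNIV" "u \<in> nodes T" "v \<in> nodes T"
  shows "real (num_leaves (attach (Suc m) T u v)) = real (num_leaves T) + 2 - hits (leaves T) u v"
proof -
  have fin: "finite (leaves T)"
    using finite_leaves assms by blast
  have "(Suc m, t) \<notin> leaves T" for t
    using assms by (auto simp: leaves_def)
  with fin have "card (leaves (attach (Suc m) T u v)) = card (leaves T - {u, v}) + 2"
    by (simp add: leaves_attach[OF assms])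
  then show ?thesis
    using card_Diff_hits[OF fin, of u v] by (simp add: num_leaves_eq_card)
qed

lemma card_leaves_of_type_attach:
  assumes "nodes T = {1..m} \<times> UNIV" "u \<in> nodes T" "v \<in> nodes T"
  shows "real (card (leaves_of_type (attach (Suc m) T u v) t))
    = real (card (leaves_of_type T t)) + 1 - hits (leaves_of_type T t) u v"
proof -
  have fin: "finite (leaves_of_type T t)"
    using finite_leaves[OF assms(1)] by (simp add: leaves_of_type_def)
  have "leaves_of_type (attach (Suc m) T u v) t = insert (Suc m, t) (leaves_of_type T t - {u, v})"
    by (cases t) (auto simp: leaves_of_type_def leaves_attach[OF assms])
  moreover have "(Suc m, t) \<notin> leaves_of_type T t"
    using assms by (auto simp: leaves_of_type_def leaves_def)
  ultimately have "card (leaves_of_type (attach (Suc m) T u v) t)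
      = card (leaves_of_type T t - {u, v}) + 1"
    using fin by simp
  then show ?thesis
    using card_Diff_hits[OF fin, of u v] by simp
qed

lemma card_leaves_of_type_one:
  "card (leaves_of_type {{(1, Type_A), (1, Type_B)}} t) = 1"
proof -
  let ?T = "{{(1, Type_A), (1, Type_B)}} :: tree"
  have nodes: "nodes ?T = {1} \<times> UNIV"
    by (auto simp: nodes_def UNIV_ctype)
  have "{e \<in> ?T. (1, t) \<in> e} = ?T"
    by (cases t) auto
  then have "degree ?T (1, t) = 1"
    by (simp add: degree_def)
  then have "leaves_of_type ?T t = {(1, t)}"
    unfolding leaves_of_type_def leaves_def nodes by (auto simp del: One_nat_def)
  then show ?thesis by simp
qed

section \<open>Parent choice and the expectation of one step\<close>

text \<open>With \<open>x\<close> and \<open>y\<close> as the laws of two independent parents, sums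
  over pairs factorise for the separate indicators, and only the diagonal survives for the collision
  indicator.\<close>

lemma sum_pair_hits:
  fixes x y :: "node \<Rightarrow> real"
  assumes V: "finite V" and L: "L \<subseteq> V" and x: "sum x V = 1" and y: "sum y V = 1"
  shows "(\<Sum>u\<in>V. \<Sum>v\<in>V. x u * y v * hits L u v) = sum x L + sum y L - (\<Sum>w\<in>L. x w * y w)"
    and "(\<Sum>u\<in>V. \<Sum>v\<in>V. x u * y v * (hits L u v)\<^sup>2)
      = sum x L + sum y L + 2 * (sum x L * sum y L) - 3 * (\<Sum>w\<in>L. x w * y w)"
proof -
  have ind: "(\<Sum>u\<in>V. g u * of_bool (u \<in> L)) = sum g L" for g :: "node \<Rightarrow> real"
    using V L by (simp add: of_bool_def if_distrib sum.If_cases Int_absorb1 cong: if_cong)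
  have 1: "(\<Sum>u\<in>V. \<Sum>v\<in>V. x u * y v * of_bool (u \<in> L)) = sum x L"
  proof -
    have "(\<Sum>u\<in>V. \<Sum>v\<in>V. x u * y v * of_bool (u \<in> L)) = (\<Sum>u\<in>V. x u * of_bool (u \<in> L)) * sum y V"
      unfolding sum_product by (intro sum.cong refl) simp
    then show ?thesis by (simp add: ind y)
  qed
  have 2: "(\<Sum>u\<in>V. \<Sum>v\<in>V. x u * y v * of_bool (v \<in> L)) = sum y L"
  proof -
    have "(\<Sum>u\<in>V. \<Sum>v\<in>V. x u * y v * of_bool (v \<in> L)) = sum x V * (\<Sum>u\<in>V. y u * of_bool (u \<in> L))"
      unfolding sum_product by (intro sum.cong refl) simp
    then show ?thesis by (simp add: ind x)
  qed
  have 3: "(\<Sum>u\<in>V. \<Sum>v\<in>V. x u * y v * (of_bool (u \<in> L) * of_bool (v \<in> L))) = sum x L * sum y L"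
    unfolding ind[symmetric] sum_product by (intro sum.cong refl) simp
  have 4: "(\<Sum>u\<in>V. \<Sum>v\<in>V. x u * y v * of_bool (u = v \<and> u \<in> L)) = (\<Sum>w\<in>L. x w * y w)"
  proof -
    have "(\<Sum>v\<in>V. x u * y v * of_bool (u = v \<and> u \<in> L)) = x u * y u * of_bool (u \<in> L)"
      if "u \<in> V" for u
    proof -
      have "(\<Sum>v\<in>V. x u * y v * of_bool (u = v \<and> u \<in> L))
        = (\<Sum>v\<in>V. if u = v then x u * y u * of_bool (u \<in> L) else 0)"
        by (intro sum.cong) auto
      then show ?thesis using V that by simp
    qed
    then show ?thesis by (simp add: ind)
  qed
  show "(\<Sum>u\<in>V. \<Sum>v\<in>V. x u * y v * hits L u v) = sum x L + sum y L - (\<Sum>w\<in>L. x w * y w)"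
    unfolding hits_def distrib_left right_diff_distrib sum.distrib sum_subtractf 1 2 4 ..
  have "(\<Sum>u\<in>V. \<Sum>v\<in>V. x u * y v * (hits L u v)\<^sup>2)
    = (\<Sum>u\<in>V. \<Sum>v\<in>V. x u * y v * of_bool (u \<in> L)) + (\<Sum>u\<in>V. \<Sum>v\<in>V. x u * y v * of_bool (v \<in> L))
     + 2 * (\<Sum>u\<in>V. \<Sum>v\<in>V. x u * y v * (of_bool (u \<in> L) * of_bool (v \<in> L)))
     - 3 * (\<Sum>u\<in>V. \<Sum>v\<in>V. x u * y v * of_bool (u = v \<and> u \<in> L))"
    unfolding hits_square sum_distrib_left sum.distrib[symmetric] sum_subtractf[symmetric]
    by (intro sum.cong refl) (simp add: algebra_simps)
  then show "(\<Sum>u\<in>V. \<Sum>v\<in>V. x u * y v * (hits L u v)\<^sup>2)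
      = sum x L + sum y L + 2 * (sum x L * sum y L) - 3 * (\<Sum>w\<in>L. x w * y w)"
    unfolding 1 2 3 4 .
qed

context
  fixes q :: real
  assumes q0: "0 \<le> q" and q1: "q \<le> 1"
begin

abbreviation kappa :: real where "kappa \<equiv> q * (1 - q)"

lemma kappa_bounds: "0 \<le> kappa" "kappa \<le> 1 / 4"
proof -
  show "0 \<le> kappa" using q0 q1 by simp
  have "0 \<le> (q - 1 / 2)\<^sup>2" by simp
  then show "kappa \<le> 1 / 4" by (simp add: power2_eq_square algebra_simps)
qed

lemma pmf_choose_parent:
  assumes nodes: "nodes T = {1..m} \<times> UNIV" and w: "w \<in> nodes T"
  shows "pmf (choose_parent q T t) w = (if snd w = t then 1 - q else q) / m"
proof -
  have m: "m \<ge> 1" using w nodes by auto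
  have "pmf (pmf_of_set (nodes_of_type T s)) w = of_bool (snd w = s) / m" for s
    using m w nodes
    by (auto simp: nodes_of_type_eq_if[OF nodes] card_cartesian_product indicator_def)
  then have "pmf (choose_parent q T t) w
    = q * (of_bool (snd w = other_type t) / m) + (1 - q) * (of_bool (snd w = t) / m)"
    using q0 q1 by (cases t) (simp_all add: choose_parent_def choose_type_def pmf_bind)
  then show ?thesis
    by (cases t; cases "snd w") auto
qed

lemma set_choose_parent:
  assumes nodes: "nodes T = {1..m} \<times> UNIV" and m: "m \<ge> 1"
  shows "set_pmf (choose_parent q T t) \<subseteq> nodes T"
  using m unfolding choose_parent_def nodes
  by (auto simp: nodes_of_type_eq_if[OF nodes] set_pmf_of_set)

lemma expectation_step:
  fixes f :: "tree \<Rightarrow> real"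
  assumes nodes: "nodes T = {1..m} \<times> UNIV" and m: "m \<ge> 1"
  shows "measure_pmf.expectation (bcmrt_step q n T) f
    = (\<Sum>u\<in>nodes T. \<Sum>v\<in>nodes T. pmf (choose_parent q T Type_A) u * pmf (choose_parent q T Type_B) v
        * f (attach n T u v))"
proof -
  let ?P = "pair_pmf (choose_parent q T Type_A) (choose_parent q T Type_B)"
  have "measure_pmf.expectation (bcmrt_step q n T) f
    = measure_pmf.expectation ?P (\<lambda>(u, v). f (attach n T u v))"
    by (simp add: bcmrt_step_def attach_def case_prod_unfold)
  also have "\<dots> = (\<Sum>z\<in>nodes T \<times> nodes T. pmf ?P z * (case z of (u, v) \<Rightarrow> f (attach n T u v)))"
    using set_choose_parent[OF nodes m] nodes
    by (subst integral_measure_pmf_real[where A = "nodes T \<times> nodes T"]) (auto simp: mult_ac)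
  also have "\<dots> = (\<Sum>u\<in>nodes T. \<Sum>v\<in>nodes T. pmf (choose_parent q T Type_A) u
      * pmf (choose_parent q T Type_B) v * f (attach n T u v))"
    unfolding sum.cartesian_product by (intro sum.cong refl) (auto simp: pmf_pair)
  finally show ?thesis .
qed

text \<open>The probability that the new node of type \<open>t\<close> chooses its parent in \<open>L\<close>.\<close>

definition hit_prob :: "nat \<Rightarrow> node set \<Rightarrow> ctype \<Rightarrow> real" where
  "hit_prob m L t = (\<Sum>w\<in>L. (if snd w = t then 1 - q else q) / m)"

text \<open>Each node is weighted \<open>1 - q\<close> by the newcomer of its own type and
  \<open>q\<close> by the other one, so the total does not see how \<open>L\<close> splits into
  types.\<close>

lemma hit_prob_sum: "hit_prob m L Type_A + hit_prob m L Type_B = card L / m"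
proof -
  have "hit_prob m L Type_A + hit_prob m L Type_B = (\<Sum>w\<in>L. 1 / real m)"
    unfolding hit_prob_def sum.distrib[symmetric]
    by (intro sum.cong refl) (use UNIV_ctype in \<open>auto simp: add_divide_distrib[symmetric] split: if_splits\<close>)
  then show ?thesis by simp
qed

lemma hit_prob_leaves:
  assumes fin: "finite (leaves T)"
  shows "hit_prob m (leaves T) t
    = ((1 - q) * card (leaves_of_type T t) + q * card (leaves_of_type T (other_type t))) / m"
proof -
  have eq: "leaves T = leaves_of_type T t \<union> leaves_of_type T (other_type t)"
    using UNIV_ctype by (cases t) (auto simp: leaves_of_type_def)
  have "hit_prob m (leaves T) t
    = (\<Sum>w\<in>leaves_of_type T t. (if snd w = t then 1 - q else q) / m)
      + (\<Sum>w\<in>leaves_of_type T (other_type t). (if snd w = t then 1 - q else q) / m)"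
    unfolding hit_prob_def eq
    using fin by (intro sum.union_disjoint) (cases t; auto simp: leaves_of_type_def)+
  also have "(\<Sum>w\<in>leaves_of_type T t. (if snd w = t then 1 - q else q) / m)
    = (\<Sum>w\<in>leaves_of_type T t. (1 - q) / m)"
    by (intro sum.cong) (auto simp: leaves_of_type_def)
  also have "(\<Sum>w\<in>leaves_of_type T (other_type t). (if snd w = t then 1 - q else q) / m)
    = (\<Sum>w\<in>leaves_of_type T (other_type t). q / m)"
    by (intro sum.cong) (cases t; auto simp: leaves_of_type_def)+
  finally show ?thesis
    by (simp add: add_divide_distrib mult_ac)
qed

text \<open>The first moment sees only \<open>card L\<close>, because both the sum and the product
  of the two probabilities of choosing a node are the same for either type. The second moment still
  depends on the types, through the product of the hitting probabilities.\<close>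

lemma expectation_hits:
  assumes nodes: "nodes T = {1..m} \<times> UNIV" and m: "m \<ge> 1" and L: "L \<subseteq> nodes T"
  defines "E \<equiv> (\<lambda>f. \<Sum>u\<in>nodes T. \<Sum>v\<in>nodes T.
    pmf (choose_parent q T Type_A) u * pmf (choose_parent q T Type_B) v * f u v)"
  shows "E (\<lambda>u v. 1) = 1"
    and "E (hits L) = card L / m - kappa * card L / (real m)\<^sup>2"
    and "E (\<lambda>u v. (hits L u v)\<^sup>2)
      = card L / m + 2 * (hit_prob m L Type_A * hit_prob m L Type_B) - 3 * (kappa * card L / (real m)\<^sup>2)"
proof -
  let ?x = "pmf (choose_parent q T Type_A)" and ?y = "pmf (choose_parent q T Type_B)"
  have fin: "finite (nodes T)" by (simp add: nodes)
  have one: "sum (pmf (choose_parent q T t)) (nodes T) = 1" for t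
    using sum_pmf_eq_1[OF fin set_choose_parent[OF nodes m]] .
  have hp: "sum (pmf (choose_parent q T t)) L = hit_prob m L t" for t
    unfolding hit_prob_def
    using pmf_choose_parent[OF nodes] L by (intro sum.cong) auto
  have "(\<Sum>w\<in>L. ?x w * ?y w) = (\<Sum>w\<in>L. kappa / (real m)\<^sup>2)"
  proof (intro sum.cong refl)
    fix w assume "w \<in> L"
    with L have "w \<in> nodes T" by auto
    then show "?x w * ?y w = kappa / (real m)\<^sup>2"
      using UNIV_ctype by (cases "snd w") (auto simp: pmf_choose_parent[OF nodes] power2_eq_square)
  qed
  then have col: "(\<Sum>w\<in>L. ?x w * ?y w) = kappa * card L / (real m)\<^sup>2"
    by simp
  show "E (\<lambda>u v. 1) = 1"
    by (simp add: E_def sum_product[symmetric] one)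
  show "E (hits L) = card L / m - kappa * card L / (real m)\<^sup>2"
    unfolding E_def by (simp only: sum_pair_hits(1)[OF fin L one one] hp hit_prob_sum col)
  show "E (\<lambda>u v. (hits L u v)\<^sup>2)
      = card L / m + 2 * (hit_prob m L Type_A * hit_prob m L Type_B) - 3 * (kappa * card L / (real m)\<^sup>2)"
    unfolding E_def by (simp only: sum_pair_hits(2)[OF fin L one one] hp hit_prob_sum col)
qed

text \<open>The probability that both newcomers choose the same node of \<open>L\<close>.\<close>

abbreviation collision :: "nat \<Rightarrow> node set \<Rightarrow> real" where
  "collision m L \<equiv> kappa * card L / (real m)\<^sup>2"

text \<open>The probability that a given old node is chosen by neither newcomer, by
  inclusion-exclusion; this is the \<rho> of the overview.\<close>

abbreviation retain :: "nat \<Rightarrow> real" where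
  "retain m \<equiv> 1 - 1 / real m + kappa / (real m)\<^sup>2"

text \<open>Leaf counts after a step are affine in \<open>hits\<close> and their squares are
  quadratic, so this one formula serves both for all leaves and for the leaves of one type.\<close>

lemma expectation_step_quadratic:
  fixes f :: "tree \<Rightarrow> real"
  assumes nodes: "nodes T = {1..m} \<times> UNIV" and m: "m \<ge> 1" and L: "L \<subseteq> nodes T"
    and f: "\<And>u v. u \<in> nodes T \<Longrightarrow> v \<in> nodes T \<Longrightarrow>
      f (attach n T u v) = a + b * hits L u v + c * (hits L u v)\<^sup>2"
  shows "measure_pmf.expectation (bcmrt_step q n T) f = a + b * (card L / m - collision m L)
    + c * (card L / m + 2 * (hit_prob m L Type_A * hit_prob m L Type_B) - 3 * collision m L)"
proof -
  let ?w = "\<lambda>u v. pmf (choose_parent q T Type_A) u * pmf (choose_parent q T Type_B) v"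
  note E = expectation_hits[OF nodes m L]
  have "measure_pmf.expectation (bcmrt_step q n T) f
    = (\<Sum>u\<in>nodes T. \<Sum>v\<in>nodes T. ?w u v * (a + b * hits L u v + c * (hits L u v)\<^sup>2))"
    unfolding expectation_step[OF nodes m] by (intro sum.cong refl) (simp add: f)
  also have "\<dots> = a * (\<Sum>u\<in>nodes T. \<Sum>v\<in>nodes T. ?w u v * 1)
    + b * (\<Sum>u\<in>nodes T. \<Sum>v\<in>nodes T. ?w u v * hits L u v)
    + c * (\<Sum>u\<in>nodes T. \<Sum>v\<in>nodes T. ?w u v * (hits L u v)\<^sup>2)"
    unfolding sum_distrib_left sum.distrib[symmetric]
    by (intro sum.cong refl) (simp add: algebra_simps)
  finally show ?thesis
    unfolding E by simp
qed

lemma expectation_step_le: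
  fixes f :: "tree \<Rightarrow> real"
  assumes nodes: "nodes T = {1..m} \<times> UNIV" and m: "m \<ge> 1" and L: "L \<subseteq> nodes T"
    and f: "\<And>u v. u \<in> nodes T \<Longrightarrow> v \<in> nodes T \<Longrightarrow> f (attach n T u v) \<le> a + b * hits L u v"
  shows "measure_pmf.expectation (bcmrt_step q n T) f \<le> a + b * (card L / m - collision m L)"
proof -
  let ?w = "\<lambda>u v. pmf (choose_parent q T Type_A) u * pmf (choose_parent q T Type_B) v"
  note E = expectation_hits[OF nodes m L]
  have "measure_pmf.expectation (bcmrt_step q n T) f
    \<le> (\<Sum>u\<in>nodes T. \<Sum>v\<in>nodes T. ?w u v * (a + b * hits L u v))"
    unfolding expectation_step[OF nodes m] by (intro sum_mono mult_left_mono f) auto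
  also have "\<dots> = a * (\<Sum>u\<in>nodes T. \<Sum>v\<in>nodes T. ?w u v * 1)
    + b * (\<Sum>u\<in>nodes T. \<Sum>v\<in>nodes T. ?w u v * hits L u v)"
    unfolding sum_distrib_left sum.distrib[symmetric]
    by (intro sum.cong refl) (simp add: algebra_simps)
  finally show ?thesis
    unfolding E by simp
qed

section \<open>Expectations along the process\<close>

lemma finite_set_bcmrt: "finite (set_pmf (bcmrt q n))"
proof (rule finite_subset)
  \<comment> \<open>A tree is a set of edges, each edge a subset of the fixed node set, so the
    support lies in a finite double power set.\<close>
  show "set_pmf (bcmrt q n) \<subseteq> Pow (Pow ({1..n} \<times> UNIV))"
    using nodes_bcmrt by (fastforce simp: nodes_def)
qed simp

lemma integrable_bcmrt [simp]: "integrable (measure_pmf (bcmrt q n)) (f :: tree \<Rightarrow> real)"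
  by (rule integrable_measure_pmf_finite[OF finite_set_bcmrt])

abbreviation expect :: "nat \<Rightarrow> (tree \<Rightarrow> real) \<Rightarrow> real" where
  "expect n f \<equiv> measure_pmf.expectation (bcmrt q n) f"

lemma expect_mono:
  assumes "\<And>T. T \<in> set_pmf (bcmrt q n) \<Longrightarrow> f T \<le> g T"
  shows "expect n f \<le> expect n g"
  using assms by (intro integral_mono_AE) (auto simp: AE_measure_pmf_iff)

lemma expect_cong:
  assumes "\<And>T. T \<in> set_pmf (bcmrt q n) \<Longrightarrow> f T = g T"
  shows "expect n f = expect n g"
  using expect_mono[of n f g] expect_mono[of n g f] assms by (simp add: order_antisym)

lemma expect_Suc:
  assumes m: "m \<ge> 1"
  shows "expect (Suc m) f = expect m (\<lambda>T. measure_pmf.expectation (bcmrt_step q (Suc m) T) f)"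
proof -
  \<comment> \<open>Here \<open>m \<ge> 1\<close> matters: the tree at time 1 does not arise by a
    step from the dummy value at 0.\<close>
  have bc: "bcmrt q (Suc m) = bind_pmf (bcmrt q m) (bcmrt_step q (Suc m))"
    using m by (cases m) auto
  have "finite (set_pmf (bcmrt_step q (Suc m) T))" if T: "T \<in> set_pmf (bcmrt q m)" for T
  proof -
    have "finite (set_pmf (choose_parent q T t))" for t
      by (rule finite_subset[OF set_choose_parent[OF nodes_bcmrt[OF T] m]])
        (simp add: nodes_bcmrt[OF T])
    then show ?thesis
      by (simp add: bcmrt_step_def)
  qed
  then show ?thesis
    unfolding bc
    by (simp add: pmf_expectation_bind[OF finite_set_bcmrt _ subset_refl]
        integral_measure_pmf[OF finite_set_bcmrt])
qed

section \<open>First and second moments of the leaf count of one type\<close>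

abbreviation type_leaves :: "ctype \<Rightarrow> tree \<Rightarrow> real" where
  "type_leaves t T \<equiv> real (card (leaves_of_type T t))"

lemma expect_type_leaves_Suc:
  assumes m: "m \<ge> 1"
  shows "expect (Suc m) (type_leaves t) = retain m * expect m (type_leaves t) + 1"
proof -
  have "expect (Suc m) (type_leaves t) = expect m (\<lambda>T. retain m * type_leaves t T + 1)"
    unfolding expect_Suc[OF m]
  proof (rule expect_cong)
    fix T assume T: "T \<in> set_pmf (bcmrt q m)"
    note nodes = nodes_bcmrt[OF T]
    have L: "leaves_of_type T t \<subseteq> nodes T"
      by (auto simp: leaves_of_type_def leaves_def)
    have drift: "retain m * type_leaves t T + 1
      = type_leaves t T + 1 - (type_leaves t T / m - collision m (leaves_of_type T t))"
      by (simp add: algebra_simps diff_divide_distrib)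
    show "measure_pmf.expectation (bcmrt_step q (Suc m) T) (type_leaves t)
      = retain m * type_leaves t T + 1"
      unfolding drift by (subst expectation_step_quadratic[OF nodes m L, where a = "type_leaves t T + 1"
            and b = "- 1" and c = 0])
        (simp_all add: card_leaves_of_type_attach[OF nodes])
  qed
  then show ?thesis by simp
qed

text \<open>Without the \<open>kappa\<close> term the recursion carries \<open>m / 2\<close> to
  \<open>(m + 1) / 2\<close>, which gives the lower bound. The upper bound is attained at
  \<open>m = 1\<close>; afterwards the factor \<open>1 - 1 / m\<close> shrinks the surplus 1/2 by
  more than the \<open>kappa\<close> term adds.\<close>

lemma expect_type_leaves_bounds:
  assumes "m \<ge> 1"
  shows "real m / 2 \<le> expect m (type_leaves t)" "expect m (type_leaves t) \<le> (real m + 1) / 2"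
proof -
  have "real m / 2 \<le> expect m (type_leaves t) \<and> expect m (type_leaves t) \<le> (real m + 1) / 2"
    using assms
  proof (induction m rule: nat_induct_at_least)
    case base
    have "expect 1 (type_leaves t) = 1"
      using card_leaves_of_type_one[of t] by simp
    then show ?case by simp
  next
    case (Suc m)
    define r where "r = 1 / real m"
    define e where "e = expect m (type_leaves t)"
    \<comment> \<open>With \<open>r\<close> for \<open>1 / m\<close> and the relation
      \<open>m * r = 1\<close>, the estimates become polynomial.\<close>
    have r: "0 < r" "r \<le> 1" "real m * r = 1"
      using Suc.hyps by (auto simp: r_def)
    have ret: "retain m = 1 - r + kappa * r\<^sup>2"
      by (simp add: r_def power_divide)
    have rec: "expect (Suc m) (type_leaves t) = (1 - r + kappa * r\<^sup>2) * e + 1"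
      using expect_type_leaves_Suc[OF Suc.hyps] by (simp add: ret e_def)
    have k: "0 \<le> kappa * r\<^sup>2" "kappa * r\<^sup>2 \<le> r\<^sup>2 / 4"
      using kappa_bounds mult_right_mono[OF kappa_bounds(2), of "r\<^sup>2"] by auto
    have e: "real m / 2 \<le> e" "e \<le> (real m + 1) / 2"
      using Suc.IH by (auto simp: e_def)
    have "(1 - r) * (real m / 2) \<le> (1 - r + kappa * r\<^sup>2) * e"
      using r k e by (intro mult_mono) auto
    moreover have "(1 - r + kappa * r\<^sup>2) * e \<le> (1 - r + r\<^sup>2 / 4) * ((real m + 1) / 2)"
      using r k e by (intro mult_mono) auto
    moreover have "(1 - r) * (real m / 2) = real m / 2 - 1 / 2"
      using r(3) by (simp add: field_simps)
    moreover have "(1 - r + r\<^sup>2 / 4) * ((real m + 1) / 2)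
      = (real m + 1 - real m * r - r + r * (real m * r) / 4 + r\<^sup>2 / 4) / 2"
      by (simp add: field_simps power2_eq_square)
    moreover have "r\<^sup>2 \<le> r"
      using r by (simp add: power2_eq_square mult_left_le)
    ultimately show ?case
      unfolding rec using r by (simp add: field_simps)
  qed
  then show "real m / 2 \<le> expect m (type_leaves t)"
    "expect m (type_leaves t) \<le> (real m + 1) / 2" by auto
qed

lemma expect_type_leaves_sq_trivial: "expect m (\<lambda>T. (type_leaves t T)\<^sup>2) \<le> (real m)\<^sup>2"
proof -
  have "expect m (\<lambda>T. (type_leaves t T)\<^sup>2) \<le> expect m (\<lambda>T. (real m)\<^sup>2)"
    using card_leaves_of_type_le nodes_bcmrt by (intro expect_mono power_mono) auto
  then show ?thesis by simp
qed

lemma expect_type_leaves_sq_Suc: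
  assumes m: "m \<ge> 1"
  shows "expect (Suc m) (\<lambda>T. (type_leaves t T)\<^sup>2)
    \<le> (1 - 2 / real m) * expect m (\<lambda>T. (type_leaves t T)\<^sup>2) + real m + 5 / 2"
proof -
  let ?f = "expect m (\<lambda>T. (type_leaves t T)\<^sup>2)" and ?k = "2 * kappa / (real m)\<^sup>2"
  have "expect (Suc m) (\<lambda>T. (type_leaves t T)\<^sup>2)
    \<le> expect m (\<lambda>T. (1 - 2 / real m + ?k) * (type_leaves t T)\<^sup>2 + 2 * type_leaves t T + 1)"
    unfolding expect_Suc[OF m]
  proof (rule expect_mono)
    fix T assume T: "T \<in> set_pmf (bcmrt q m)"
    note nodes = nodes_bcmrt[OF T]
    let ?L = "leaves_of_type T t" and ?X = "type_leaves t T"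
    have L: "?L \<subseteq> nodes T"
      by (auto simp: leaves_of_type_def leaves_def)
    have "measure_pmf.expectation (bcmrt_step q (Suc m) T) (\<lambda>T. (type_leaves t T)\<^sup>2)
      \<le> (?X\<^sup>2 + 2 * ?X + 1) + (- 2 * ?X) * (?X / m - collision m ?L)"
    proof (rule expectation_step_le[OF nodes m L])
      \<comment> \<open>The square of \<open>X + (1 - hits)\<close> is expanded so that
        \<open>hits\<close> is quadratic only in the last term, which is at most 1.\<close>
      fix u v assume "u \<in> nodes T" "v \<in> nodes T"
      then have "(type_leaves t (attach (Suc m) T u v))\<^sup>2
        = ?X\<^sup>2 + 2 * ?X - 2 * ?X * hits ?L u v + (1 - hits ?L u v)\<^sup>2"
        by (simp add: card_leaves_of_type_attach[OF nodes] power2_eq_square algebra_simps)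
      then show "(type_leaves t (attach (Suc m) T u v))\<^sup>2
        \<le> (?X\<^sup>2 + 2 * ?X + 1) + (- 2 * ?X) * hits ?L u v"
        using one_minus_hits_square_le[of ?L u v] by simp
    qed
    also have "\<dots> = (1 - 2 / real m + ?k) * ?X\<^sup>2 + 2 * ?X + 1"
      by (simp add: algebra_simps power2_eq_square diff_divide_distrib)
    finally show "measure_pmf.expectation (bcmrt_step q (Suc m) T) (\<lambda>T. (type_leaves t T)\<^sup>2)
      \<le> (1 - 2 / real m + ?k) * ?X\<^sup>2 + 2 * ?X + 1" .
  qed
  also have "\<dots> = (1 - 2 / real m + ?k) * ?f + 2 * expect m (type_leaves t) + 1"
    by simp
  also have "\<dots> = (1 - 2 / real m) * ?f + ?k * ?f + 2 * expect m (type_leaves t) + 1"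
    by (simp add: algebra_simps)
  \<comment> \<open>The trivial bound on the second moment suffices here, since its coefficient is
    of order \<open>1 / m^2\<close>. The contributions \<open>m + 1\<close>, \<open>1\<close> and
    \<open>1 / 2\<close> add up to \<open>m + 5 / 2\<close>.\<close>
  also have "?k * ?f \<le> ?k * (real m)\<^sup>2"
    using kappa_bounds expect_type_leaves_sq_trivial by (intro mult_left_mono) auto
  also have "?k * (real m)\<^sup>2 \<le> 1 / 2"
    using kappa_bounds m by simp
  finally show ?thesis
    using expect_type_leaves_bounds(2)[OF m, of t] by simp
qed

text \<open>The leading term is the square of \<open>m / 2\<close>; with the lower bound on the
  mean, the mean square deviation from \<open>m / 2\<close> is at most \<open>3 * m / 2\<close>.
  Starting at 2 keeps \<open>1 - 2 / m\<close> nonnegative, and the coefficient 3/2 is what the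
  trivial bound 4 requires there.\<close>

lemma expect_type_leaves_sq_le:
  assumes "m \<ge> 2"
  shows "expect m (\<lambda>T. (type_leaves t T)\<^sup>2) \<le> (real m)\<^sup>2 / 4 + 3 * real m / 2"
  using assms
proof (induction m rule: nat_induct_at_least)
  case base
  then show ?case using expect_type_leaves_sq_trivial[of 2 t] by simp
next
  case (Suc m)
  have m: "m \<ge> 1" using Suc.hyps by simp
  let ?f = "expect m (\<lambda>T. (type_leaves t T)\<^sup>2)"
  have "expect (Suc m) (\<lambda>T. (type_leaves t T)\<^sup>2) \<le> (1 - 2 / real m) * ?f + real m + 5 / 2"
    by (rule expect_type_leaves_sq_Suc[OF m])
  also have "(1 - 2 / real m) * ?f \<le> (1 - 2 / real m) * ((real m)\<^sup>2 / 4 + 3 * real m / 2)"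
    using Suc by (intro mult_left_mono) auto
  also have "\<dots> = (real m)\<^sup>2 / 4 + real m - 3"
    using m by (simp add: field_simps power2_eq_square)
  finally have "expect (Suc m) (\<lambda>T. (type_leaves t T)\<^sup>2)
    \<le> (real m)\<^sup>2 / 4 + 2 * real m - 1 / 2" by simp
  moreover have "(real (Suc m))\<^sup>2 / 4 + 3 * real (Suc m) / 2 = (real m)\<^sup>2 / 4 + 2 * real m + 7 / 4"
    by (simp add: power2_eq_square field_simps)
  ultimately show ?case by linarith
qed

section \<open>Variance of the total leaf count\<close>

abbreviation leaf_count :: "tree \<Rightarrow> real" where
  "leaf_count T \<equiv> real (num_leaves T)"

abbreviation variance_at :: "nat \<Rightarrow> real" where
  "variance_at n \<equiv> measure_pmf.variance (bcmrt q n) leaf_count"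

text \<open>The conditional variance of the leaf count after one step from \<open>T\<close>.\<close>

definition step_variance :: "nat \<Rightarrow> tree \<Rightarrow> real" where
  "step_variance m T = leaf_count T / m
     + 2 * (hit_prob m (leaves T) Type_A * hit_prob m (leaves T) Type_B) - 3 * collision m (leaves T)
     - (leaf_count T / m - collision m (leaves T))\<^sup>2"

text \<open>The next count is the old one plus 2 minus \<open>hits\<close>, and
  \<open>step_variance\<close> is the second moment of \<open>hits\<close> minus the square of its
  mean.\<close>

lemma expectation_step_leaf_count:
  assumes nodes: "nodes T = {1..m} \<times> UNIV" and m: "m \<ge> 1"
  shows "measure_pmf.expectation (bcmrt_step q (Suc m) T) leaf_count = retain m * leaf_count T + 2"
    and "measure_pmf.expectation (bcmrt_step q (Suc m) T) (\<lambda>T. (leaf_count T)\<^sup>2)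
      = (retain m * leaf_count T + 2)\<^sup>2 + step_variance m T"
proof -
  have L: "leaves T \<subseteq> nodes T"
    by (auto simp: leaves_def)
  let ?N = "leaf_count T"
  have drift: "retain m * ?N + 2 = ?N + 2 - (?N / m - collision m (leaves T))"
    by (simp add: num_leaves_eq_card algebra_simps)
  show "measure_pmf.expectation (bcmrt_step q (Suc m) T) leaf_count = retain m * ?N + 2"
    unfolding drift
    by (subst expectation_step_quadratic[OF nodes m L, where a = "?N + 2" and b = "- 1" and c = 0])
      (simp_all add: num_leaves_attach[OF nodes], simp add: num_leaves_eq_card)
  show "measure_pmf.expectation (bcmrt_step q (Suc m) T) (\<lambda>T. (leaf_count T)\<^sup>2)
      = (retain m * ?N + 2)\<^sup>2 + step_variance m T"
  proof -
    have "measure_pmf.expectation (bcmrt_step q (Suc m) T) (\<lambda>T. (leaf_count T)\<^sup>2)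
      = (?N + 2)\<^sup>2 + (- 2 * (?N + 2)) * (card (leaves T) / m - collision m (leaves T))
        + 1 * (card (leaves T) / m
          + 2 * (hit_prob m (leaves T) Type_A * hit_prob m (leaves T) Type_B)
          - 3 * collision m (leaves T))"
      by (rule expectation_step_quadratic[OF nodes m L])
        (simp add: num_leaves_attach[OF nodes] power2_eq_square algebra_simps)
    also have "\<dots> = (?N + 2 - (?N / m - collision m (leaves T)))\<^sup>2 + step_variance m T"
    proof -
      have "a\<^sup>2 + (- 2 * a) * x + 1 * (y + z - w) = (a - x)\<^sup>2 + (y + z - w - x\<^sup>2)"
        for a x y z w :: real
        by (simp add: power2_eq_square algebra_simps)
      then show ?thesis
        unfolding step_variance_def num_leaves_eq_card[symmetric] .
    qed
    finally show ?thesis unfolding drift .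
  qed
qed

text \<open>This is the law of total variance: the conditional mean is affine in the leaf count with
  slope \<open>retain m\<close>, so its variance is that of the old count times the squared
  slope.\<close>

lemma variance_Suc:
  assumes m: "m \<ge> 1"
  shows "variance_at (Suc m) = (retain m)\<^sup>2 * variance_at m + expect m (step_variance m)"
proof -
  have 1: "expect (Suc m) leaf_count = retain m * expect m leaf_count + 2"
  proof -
    have "expect (Suc m) leaf_count = expect m (\<lambda>T. retain m * leaf_count T + 2)"
      unfolding expect_Suc[OF m]
      by (intro expect_cong expectation_step_leaf_count nodes_bcmrt m)
    then show ?thesis by simp
  qed
  have 2: "expect (Suc m) (\<lambda>T. (leaf_count T)\<^sup>2)
    = (retain m)\<^sup>2 * expect m (\<lambda>T. (leaf_count T)\<^sup>2) + 4 * retain m * expect m leaf_count + 4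
      + expect m (step_variance m)"
  proof -
    have "expect (Suc m) (\<lambda>T. (leaf_count T)\<^sup>2)
      = expect m (\<lambda>T. (retain m * leaf_count T + 2)\<^sup>2 + step_variance m T)"
      unfolding expect_Suc[OF m]
      by (intro expect_cong expectation_step_leaf_count nodes_bcmrt m)
    also have "\<dots> = expect m (\<lambda>T. (retain m)\<^sup>2 * (leaf_count T)\<^sup>2 + (4 * retain m) * leaf_count T + 4
        + step_variance m T)"
      by (intro expect_cong) (simp only: power2_sum power_mult_distrib, simp)
    finally show ?thesis by simp
  qed
  have var: "variance_at n = expect n (\<lambda>T. (leaf_count T)\<^sup>2) - (expect n leaf_count)\<^sup>2" for n
    by (rule measure_pmf.variance_eq) simp_all
  have alg: "r\<^sup>2 * f + 4 * r * e + 4 + s - (r * e + 2)\<^sup>2 = r\<^sup>2 * (f - e\<^sup>2) + s" for r e f s :: real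
    by (simp add: power2_eq_square algebra_simps)
  show ?thesis
    unfolding var[of "Suc m"] var[of m] unfolding 1 2 by (rule alg)
qed

text \<open>With \<open>a\<close> and \<open>b\<close> the proportions of leaves in the two types,
  the bound is \<open>a * (1 - a) + b * (1 - b) - 2 / m\<close>. It has no mixed term in
  \<open>a\<close> and \<open>b\<close>, so moments of single types suffice to estimate its
  mean.\<close>

lemma step_variance_ge:
  assumes nodes: "nodes T = {1..m} \<times> UNIV" and m: "m \<ge> 1"
  shows "step_variance m T \<ge> (type_leaves Type_A T + type_leaves Type_B T) / m
    - ((type_leaves Type_A T)\<^sup>2 + (type_leaves Type_B T)\<^sup>2) / (real m)\<^sup>2 - 2 / m"
proof -
  note fin = finite_leaves[OF nodes]
  define a where "a = type_leaves Type_A T / m"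
  define b where "b = type_leaves Type_B T / m"
  define s where "s = collision m (leaves T)"
  let ?p = "hit_prob m (leaves T) Type_A" and ?r = "hit_prob m (leaves T) Type_B"
  have N: "leaf_count T = type_leaves Type_A T + type_leaves Type_B T"
    using card_leaves_eq[OF fin] by (simp add: num_leaves_eq_card)
  have p: "?p = (1 - q) * a + q * b" and r: "?r = (1 - q) * b + q * a"
    by (simp_all add: hit_prob_leaves[OF fin] a_def b_def add_divide_distrib)
  have "leaf_count T \<le> 2 * real m"
    using card_leaves_of_type_le[OF nodes, of Type_A] card_leaves_of_type_le[OF nodes, of Type_B]
    by (simp add: N)
  then have "s \<le> 1 / 4 * (2 * real m) / (real m)\<^sup>2"
    unfolding s_def num_leaves_eq_card using kappa_bounds
    by (intro divide_right_mono mult_mono) auto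
  then have s_le: "s \<le> 1 / (2 * real m)"
    using m by (simp add: power2_eq_square field_simps)
  have s0: "0 \<le> s"
    unfolding s_def using kappa_bounds by simp
  have "1 / (2 * real m) \<le> 1"
    using m by simp
  with s_le s0 have ss: "s\<^sup>2 \<le> s"
    by (simp add: power2_eq_square mult_left_le)
  have ab: "0 \<le> a" "0 \<le> b"
    by (simp_all add: a_def b_def)
  have sum: "leaf_count T / m = a + b"
    by (simp add: N a_def b_def add_divide_distrib)
  have "step_variance m T = (a + b) + 2 * (?p * ?r) - 3 * s - ((a + b) - s)\<^sup>2"
    unfolding step_variance_def sum s_def ..
  \<comment> \<open>The product of the hitting probabilities equals
    \<open>a * b + kappa * (a - b)^2\<close>. Its part \<open>2 * a * b\<close> cancels the mixed
    term of the square, and the rest is nonnegative.\<close>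
  also have "\<dots> = (a + b) - (a\<^sup>2 + b\<^sup>2) + 2 * kappa * (a - b)\<^sup>2 - 3 * s + 2 * (a + b) * s - s\<^sup>2"
    unfolding p r by (simp add: power2_eq_square algebra_simps)
  also have "\<dots> \<ge> (a + b) - (a\<^sup>2 + b\<^sup>2) - 4 * s"
  proof -
    have "0 \<le> 2 * kappa * (a - b)\<^sup>2" "0 \<le> 2 * (a + b) * s"
      using kappa_bounds ab s0 by simp_all
    then show ?thesis using ss by linarith
  qed
  finally have "step_variance m T \<ge> (a + b) - (a\<^sup>2 + b\<^sup>2) - 4 * s" .
  moreover have "4 * s \<le> 2 / m"
    using s_le by (simp add: field_simps)
  ultimately show ?thesis
    by (simp add: a_def b_def power_divide add_divide_distrib)
qed

section \<open>Linear growth of the variance\<close>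

text \<open>The moment bounds leave \<open>1 - 1 / 2 - 3 / m - 2 / m\<close>, which reaches 1/4
  exactly at \<open>m = 20\<close>.\<close>

lemma expect_step_variance_ge:
  assumes m: "m \<ge> 20"
  shows "expect m (step_variance m) \<ge> 1 / 4"
proof -
  have m1: "m \<ge> 1" "m \<ge> 2" using m by auto
  let ?e = "\<lambda>t. expect m (type_leaves t)" and ?f = "\<lambda>t. expect m (\<lambda>T. (type_leaves t T)\<^sup>2)"
  have sq: "?f t / (real m)\<^sup>2 \<le> 1 / 4 + 3 / (2 * real m)" for t
  proof -
    have "?f t / (real m)\<^sup>2 \<le> ((real m)\<^sup>2 / 4 + 3 * real m / 2) / (real m)\<^sup>2"
      by (intro divide_right_mono expect_type_leaves_sq_le m1) simp
    also have "\<dots> = 1 / 4 + 3 / (2 * real m)"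
      using m1 by (simp add: field_simps power2_eq_square)
    finally show ?thesis .
  qed
  have mean: "?e t / m \<ge> 1 / 2" for t
    using expect_type_leaves_bounds(1)[OF m1(1), of t] m1 by (simp add: field_simps)
  have "(?e Type_A + ?e Type_B) / m - (?f Type_A + ?f Type_B) / (real m)\<^sup>2 - 2 / m
    = expect m (\<lambda>T. (type_leaves Type_A T + type_leaves Type_B T) / m
      - ((type_leaves Type_A T)\<^sup>2 + (type_leaves Type_B T)\<^sup>2) / (real m)\<^sup>2 - 2 / m)"
    by simp
  also have "\<dots> \<le> expect m (step_variance m)"
    by (intro expect_mono step_variance_ge nodes_bcmrt m1)
  finally have "expect m (step_variance m)
    \<ge> (?e Type_A / m + ?e Type_B / m) - (?f Type_A / (real m)\<^sup>2 + ?f Type_B / (real m)\<^sup>2) - 2 / m"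
    by (simp only: add_divide_distrib)
  moreover have "3 / (2 * real m) \<le> 3 / 40" "2 / real m \<le> 1 / 10"
    using m by (simp_all add: field_simps)
  ultimately show ?thesis
    using sq[of Type_A] sq[of Type_B] mean[of Type_A] mean[of Type_B] by linarith
qed

text \<open>For slope \<open>c\<close>, one step loses at most \<open>2 * c\<close> through
  \<open>1 - 2 / m\<close>, must gain \<open>c\<close>, and receives at least 1/4; hence
  \<open>c = 1 / 12\<close>. The shift by 20 makes the bound 0 at the start of the
  induction.\<close>

lemma variance_ge:
  assumes "m \<ge> 20"
  shows "variance_at m \<ge> (real m - 20) / 12"
  using assms
proof (induction m rule: nat_induct_at_least)
  case base
  have "0 \<le> variance_at 20"
    by (rule measure_pmf.variance_positive)
  then show ?case by simp
next
  case (Suc m)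
  have m: "m \<ge> 1" using Suc.hyps by simp
  define r where "r = 1 / real m"
  have r: "0 < r" "r \<le> 1 / 20" "real m * r = 1"
    using Suc.hyps by (auto simp: r_def field_simps)
  have "1 - 2 * r \<le> (1 - r)\<^sup>2"
    by (simp add: power2_diff)
  also have "(1 - r)\<^sup>2 \<le> (retain m)\<^sup>2"
    using kappa_bounds r by (intro power_mono) (auto simp: r_def)
  finally have "(1 - 2 * r) * ((real m - 20) / 12) \<le> (retain m)\<^sup>2 * variance_at m"
    using Suc r by (intro mult_mono) auto
  moreover have "(1 - 2 * r) * ((real m - 20) / 12) = (real m - 20 - 2 * (real m * r) + 40 * r) / 12"
    by (simp add: algebra_simps)
  ultimately show ?case
    unfolding variance_Suc[OF m] using expect_step_variance_ge[OF Suc.hyps] r by simp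
qed

end

theorem theorem2:
  fixes q :: real
  assumes "0 \<le> q" and "q < 1"
  shows "(\<lambda>n. measure_pmf.variance (bcmrt q n) (\<lambda>T. real (num_leaves T))) \<in> \<Omega>(\<lambda>n. real n)"
\<comment> \<open>For \<open>n \<ge> 40\<close> the shift by 20 costs at most half of
  \<open>n\<close>, which halves 1/12 to 1/24.\<close>
proof (rule landau_omega.bigI[where c = "1 / 24"])
  show "\<forall>\<^sub>F n in sequentially. norm (measure_pmf.variance (bcmrt q n) (\<lambda>T. real (num_leaves T)))
    \<ge> 1 / 24 * norm (real n)"
    using eventually_ge_at_top[of 40]
  proof eventually_elim
    case (elim n)
    then have "(real n - 20) / 12 \<le> measure_pmf.variance (bcmrt q n) (\<lambda>T. real (num_leaves T))"
      using assms by (intro variance_ge) auto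
    with elim show ?case by simp
  qed
qed simp

end
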